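(* Fix an even integer $j\ge 2$. For $n\ge j$, define polynomials $q_0,\dots,q_n$ (depending on $n$) by $q_0(x)=1$, $q_1(x)=x$ and $x\,q_k(x)=(k+1)\,q_{k+1}(x)+(n-k+1)\,q_{k-1}(x)$ for $1\le k\le n-1$, and let $r_0$ and $r_1$ be the smallest and the largest real root of $q_j$. Then there are constants $C>0$ and $N$ (depending on $j$) such that for all $n\ge N$ and all $x$ with $r_0\le x\le r_1$, we have $|q_j(x)|\le C\,n^{j/2}$.
   Context: The polynomial $q_j$ satisfies $q_j(n-2x)=K_j(x)$, where $K_j(x)=\sum_{i=0}^{j}(-1)^i\binom{x}{i}\binom{n-x}{j-i}$ is the binary Krawtchouk polynomial; in particular $q_j$ has $j$ real roots. *)

theory Defs
  imports Complex_Main "HOL-Computational_Algebra.Polynomial"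
begin

text \<open>
  The polynomials \<open>q\<^sub>0, \<dots>, q\<^sub>n\<close> (the index bound \<open>k \<le> n\<close> is left to the statements using them).
  The recursion solves the three-term recurrence for its highest-index term; the recurrence
  itself is lemma \<open>q_recurrence\<close>.
\<close>

fun q :: "nat \<Rightarrow> nat \<Rightarrow> real poly" where
  "q n 0 = 1"
| "q n (Suc 0) = [:0, 1:]"
| "q n (Suc (Suc k)) =
     smult (1 / (real k + 2)) ([:0, 1:] * q n (Suc k) - smult (real n - real k) (q n k))"

lemma q_recurrence:
  assumes "1 \<le> k"
  shows "x * poly (q n k) x
    = (real k + 1) * poly (q n (k + 1)) x + (real n - real k + 1) * poly (q n (k - 1)) x"
proof -
  from assms obtain m where "k = Suc m" by (cases k) auto
  then show ?thesis by (simp add: field_simps)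
qed

end

theory Submission imports Defs begin

text \<open>
  To the right of a multiple \<open>c * sqrt n\<close> of \<open>sqrt n\<close> the recurrence propagates
  \<open>q\<^sub>k\<^sub>+\<^sub>1 \<ge> sqrt n * q\<^sub>k > 0\<close>, so by parity all real roots of \<open>q\<^sub>j\<close> lie within distance
  \<open>c * sqrt n\<close> of the origin. On that interval the recurrence yields
  \<open>\<bar>q\<^sub>k\<bar> \<le> (D * sqrt n) ^ k\<close> by induction. Since \<open>Min\<close> and \<open>Max\<close> are unspecified on the empty
  set, one also needs that \<open>q\<^sub>j\<close> has a real root: at the largest root of \<open>q\<^sub>k\<close> the recurrence
  makes \<open>q\<^sub>k\<^sub>+\<^sub>1\<close> negative, so that \<open>q\<^sub>k\<^sub>+\<^sub>1\<close> has a root further to the right.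
\<close>

declare q.simps(3) [simp del]

lemma q_Suc_Suc:
  "(real k + 2) * poly (q n (Suc (Suc k))) x
    = x * poly (q n (Suc k)) x - (real n - real k) * poly (q n k) x"
  by (simp add: q.simps(3) field_simps)

lemma poly_q_minus: "poly (q n k) (- x) = (- 1) ^ k * poly (q n k) x"
  by (induction n k rule: q.induct) (simp_all add: q.simps(3) algebra_simps)

text \<open>The induction hypothesis at \<open>k\<close> bounds the subtracted term of the
  recurrence by \<open>sqrt n * poly (q n (Suc k)) x\<close>. Of the \<open>j + 1\<close> such
  multiples that \<open>x\<close> supplies, one absorbs this term and the other
  \<open>j \<ge> k + 2\<close> pay for the factor \<open>k + 2\<close>. The index \<open>j\<close>
  stays fixed so that one threshold on \<open>x\<close> serves every \<open>k\<close>.\<close>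

lemma q_growth_right:
  assumes "Suc k \<le> j" "j \<le> n" "x \<ge> (real j + 1) * sqrt n"
  shows "poly (q n k) x > 0 \<and> sqrt n * poly (q n k) x \<le> poly (q n (Suc k)) x"
  using assms(1)
proof (induction k)
  case 0
  have "1 * sqrt n \<le> (real j + 1) * sqrt n"
    by (intro mult_right_mono) auto
  then show ?case using assms(3) by simp
next
  case (Suc k)
  define s a b where "s = sqrt n" and "a = poly (q n k) x" and "b = poly (q n (Suc k)) x"
  have s: "s > 0" "s * s = n"
    using Suc.prems assms(2) by (auto simp: s_def)
  have IH: "a > 0" "s * a \<le> b"
    using Suc by (auto simp: s_def a_def b_def)
  have "0 < s * a" using s IH by simp
  then have b: "b > 0" using IH(2) by linarith
  have "(real n - real k) * a \<le> s * s * a"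
    using IH s by (intro mult_right_mono) auto
  also have "\<dots> \<le> s * b"
    using mult_left_mono[OF IH(2), of s] s(1) by (simp only: mult.assoc)
  finally have "(real n - real k) * a \<le> s * b" .
  moreover have "(real j + 1) * s * b \<le> x * b"
    using assms(3) b by (intro mult_right_mono) (auto simp: s_def)
  moreover have "(real k + 2) * (s * b) \<le> real j * (s * b)"
    using Suc.prems s b by (intro mult_right_mono) auto
  ultimately have "(real k + 2) * (s * b) \<le> (real k + 2) * poly (q n (Suc (Suc k))) x"
    unfolding q_Suc_Suc by (simp add: algebra_simps flip: a_def b_def)
  then have "s * b \<le> poly (q n (Suc (Suc k))) x"
    by simp
  then show ?case using b by (simp add: s_def b_def)
qed

lemma q_pos_right:
  assumes "1 \<le> k" "k \<le> n" "x \<ge> (real k + 1) * sqrt n"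
  shows "poly (q n k) x > 0"
proof -
  obtain m where m: "k = Suc m" using assms(1) by (cases k) auto
  have "0 < sqrt n * poly (q n m) x"
    using q_growth_right[of m k n x] assms m by simp
  also have "\<dots> \<le> poly (q n k) x"
    using q_growth_right[of m k n x] assms m by simp
  finally show ?thesis .
qed

lemma q_root_bound:
  assumes "1 \<le> k" "k \<le> n" "poly (q n k) t = 0"
  shows "\<bar>t\<bar> \<le> (real k + 1) * sqrt n"
  using q_pos_right[OF assms(1,2), of t] q_pos_right[OF assms(1,2), of "- t"] assms(3)
  by (fastforce simp: poly_q_minus abs_if)

lemma finite_roots_q:
  assumes "1 \<le> k" "k \<le> n"
  shows "finite {t. poly (q n k) t = 0}"
proof (rule poly_roots_finite)
  show "q n k \<noteq> 0"
    using q_pos_right[OF assms order_refl] by auto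
qed

text \<open>The positivity claims carry the induction: the last one gives the sign of the next
  polynomial at the current root, and the middle one becomes the last one after the step, because
  the new root lies strictly to the right.\<close>

lemma q_ex_largest_root:
  assumes "Suc k \<le> n"
  shows "\<exists>z. poly (q n (Suc k)) z = 0 \<and> (\<forall>x>z. poly (q n (Suc k)) x > 0)
           \<and> (\<forall>x\<ge>z. poly (q n k) x > 0)"
  using assms
proof (induction k)
  case 0
  show ?case by (intro exI[of _ 0]) simp
next
  case (Suc k)
  let ?p = "q n (Suc (Suc k))"
  obtain y where y: "poly (q n (Suc k)) y = 0" "\<forall>x>y. poly (q n (Suc k)) x > 0"
      "\<forall>x\<ge>y. poly (q n k) x > 0"
    using Suc by auto
  have "(real k + 2) * poly ?p y = - ((real n - real k) * poly (q n k) y)"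
    by (simp only: q_Suc_Suc y(1))
  also have "\<dots> < 0"
    using y(3) Suc.prems by (simp add: zero_less_mult_iff)
  finally have neg: "poly ?p y < 0"
    by (simp add: mult_less_0_iff)
  define R where "R = {t. poly ?p t = 0}"
  have fin: "finite R"
    unfolding R_def using Suc.prems by (intro finite_roots_q) auto
  have right: "\<exists>r>x. r \<in> R" if x: "poly ?p x < 0" for x
  proof -
    define w where "w = max (x + 1) ((real (Suc (Suc k)) + 1) * sqrt n)"
    have "x < w" by (simp add: w_def)
    moreover have "poly ?p w > 0"
      using Suc.prems by (intro q_pos_right) (auto simp: w_def)
    ultimately show ?thesis
      using poly_IVT_pos[of x w ?p] x by (auto simp: R_def)
  qed
  define z where "z = Max R"
  have "R \<noteq> {}" using right[OF neg] by auto
  then have z: "z \<in> R" unfolding z_def using fin by simp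
  have max: "r \<le> z" if "r \<in> R" for r
    using that fin by (simp add: z_def)
  have "y < z" using right[OF neg] max by force
  moreover have "poly ?p x > 0" if "x > z" for x
  proof (rule ccontr)
    assume "\<not> poly ?p x > 0"
    moreover have "poly ?p x \<noteq> 0" using max[of x] that by (auto simp: R_def)
    ultimately have "poly ?p x < 0" by linarith
    then show False using right[of x] max that by force
  qed
  ultimately show ?case
    using y(2) z by (intro exI[of _ z]) (auto simp: R_def)
qed

text \<open>Taking \<open>D - 1\<close> rather than \<open>D\<close> in the range of
  \<open>x\<close> leaves room for the lower-order term of the recurrence.\<close>

lemma q_bound:
  assumes "k \<le> n" "\<bar>x\<bar> \<le> (D - 1) * sqrt n" "D \<ge> 2"
  shows "\<bar>poly (q n k) x\<bar> \<le> (D * sqrt n) ^ k"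
  using assms
proof (induction n k rule: q.induct)
  case (2 n)
  have "(D - 1) * sqrt n \<le> D * sqrt n" by (intro mult_right_mono) auto
  from order_trans[OF 2(2) this] show ?case by simp
next
  case (3 n k)
  define s a b where "s = sqrt n" and "a = poly (q n k) x" and "b = poly (q n (Suc k)) x"
  have s: "s \<ge> 0" "s * s = n" by (auto simp: s_def)
  have IH: "\<bar>a\<bar> \<le> (D * s) ^ k" "\<bar>b\<bar> \<le> (D * s) ^ Suc k"
    using 3 by (auto simp: s_def a_def b_def)
  have "(real k + 2) * \<bar>poly (q n (Suc (Suc k))) x\<bar> = \<bar>x * b - (real n - real k) * a\<bar>"
    by (simp only: a_def b_def flip: q_Suc_Suc) (simp add: abs_mult)
  also have "\<dots> \<le> \<bar>x\<bar> * \<bar>b\<bar> + (real n - real k) * \<bar>a\<bar>"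
    using abs_triangle_ineq4[of "x * b" "(real n - real k) * a"] 3(3) by (simp add: abs_mult)
  also have "\<dots> \<le> ((D - 1) * s) * (D * s) ^ Suc k + (s * s) * (D * s) ^ k"
    using 3(4,5) IH s by (intro add_mono mult_mono) (auto simp: s_def)
  also have "\<dots> = (D * (D - 1) + 1) * (s\<^sup>2 * (D * s) ^ k)"
    by (simp add: algebra_simps power2_eq_square)
  \<comment> \<open>This amounts to \<open>D \<ge> 1\<close>.\<close>
  also have "\<dots> \<le> D\<^sup>2 * (s\<^sup>2 * (D * s) ^ k)"
    using 3(5) s by (intro mult_right_mono) (auto simp: algebra_simps power2_eq_square)
  also have "\<dots> = 1 * (D * s) ^ Suc (Suc k)"
    by (simp add: algebra_simps power2_eq_square)
  also have "\<dots> \<le> (real k + 2) * (D * s) ^ Suc (Suc k)"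
    using 3(5) s by (intro mult_right_mono) auto
  finally show ?case by (simp add: s_def)
qed simp

theorem theorem2:
  fixes j :: nat
  assumes "even j" and "j \<ge> 2"
  shows "\<exists>C::real. C > 0 \<and> (\<exists>N::nat. N \<ge> j \<and> (\<forall>n\<ge>N. \<forall>x::real.
           Min {t::real. poly (q n j) t = 0} \<le> x \<and> x \<le> Max {t::real. poly (q n j) t = 0} \<longrightarrow>
           \<bar>poly (q n j) x\<bar> \<le> C * real n powr (real j / 2)))"
proof (intro exI conjI allI impI)
  \<comment> \<open>Chosen so that \<open>D - 1\<close> is the constant \<open>j + 1\<close> of
    \<open>q_root_bound\<close>.\<close>
  define D where "D = real j + 2"
  show "D ^ j > 0" by (simp add: D_def)
  show "j \<le> j" ..
  fix n :: nat and x :: real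
  let ?R = "{t::real. poly (q n j) t = 0}"
  assume n: "j \<le> n" and x: "Min ?R \<le> x \<and> x \<le> Max ?R"
  obtain m where m: "j = Suc m" using assms(2) by (cases j) auto
  have fin: "finite ?R" using assms n by (intro finite_roots_q) auto
  have "?R \<noteq> {}" using q_ex_largest_root[of m n] n m by auto
  then have "Min ?R \<in> ?R" "Max ?R \<in> ?R"
    using Min_in[of ?R] Max_in[of ?R] fin by blast+
  then have "\<bar>Min ?R\<bar> \<le> (real j + 1) * sqrt n" "\<bar>Max ?R\<bar> \<le> (real j + 1) * sqrt n"
    using assms n by (auto intro!: q_root_bound)
  then have "\<bar>x\<bar> \<le> (D - 1) * sqrt n" using x unfolding D_def by simp argo
  then have "\<bar>poly (q n j) x\<bar> \<le> (D * sqrt n) ^ j"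
    using n by (intro q_bound) (auto simp: D_def)
  also have "\<dots> = D ^ j * sqrt n ^ j" by (simp add: power_mult_distrib)
  also have "sqrt n ^ j = real n powr (real j / 2)"
    using assms n by (simp add: powr_half_sqrt [symmetric] powr_powr flip: powr_realpow)
  finally show "\<bar>poly (q n j) x\<bar> \<le> D ^ j * real n powr (real j / 2)" .
qed

end
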